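(* (1) Let $\omega:\mathfrak h/\mathfrak z\times\mathfrak h/\mathfrak z\to V=C^\infty(\mathfrak g/\mathfrak q)$ be the map $$\omega\bigl((x,y),(x',y');r\bigr)=\eta_\lambda(r)\bigl(\beta(x,y')-\beta(x',y)\bigr).$$ Then $\omega$ is a Lie algebra (2-)cocycle for $\mathfrak h/\mathfrak z$ with values in $V$, regarded as a trivial $U(\mathfrak h/\mathfrak z)$-module. (2) The Poisson bracket on $\mathfrak g=\mathfrak h^*$ given by $$\{\phi,\psi\}(p,q,r)=\frac{e^{2\lambda r}-1}{2\lambda}\bigl(\beta(x,y')-\beta(x',y)\bigr),\qquad d\phi(p,q,r)=(x,y,z),\ d\psi(p,q,r)=(x',y',z'),$$ is the sum of the (trivial) linear Poisson bracket on $(\mathfrak h/\mathfrak z)^*$ and $\omega$. (3) The space $V=C^\infty(\mathfrak g/\mathfrak q)$ is canonically contained in $C^\infty(\mathfrak g)$, in such a way that $\mathfrak h\cap V=\mathfrak z$. Thus the Poisson bracket in (2) is a cocycle perturbation of the linear Poisson bracket on $\mathfrak h^*$.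
   Context: Fix an integer $n\ge1$ and a nonzero real number $\lambda$. $\beta$ is the usual inner product on $\mathbb R^n$ and $\eta_\lambda(r)=\frac{e^{2\lambda r}-1}{2\lambda}$. $\mathfrak h$ is the Heisenberg Lie algebra with basis $\mathbf{x_i},\mathbf{y_i}$ $(1\le i\le n)$, $\mathbf z$ and brackets $[\mathbf{x_i},\mathbf{y_j}]=\delta_{ij}\mathbf z$, $\mathbf z$ central; its center is $\mathfrak z=\mathbb R\mathbf z$. $\mathfrak g=\mathfrak h^*$ has dual basis $\mathbf{p_i},\mathbf{q_i},\mathbf r$, and $\mathfrak q=\mathfrak z^\bot=\operatorname{span}(\mathbf{p_i},\mathbf{q_i})\subseteq\mathfrak g$. One writes $(p,q,r)$ for elements of $\mathfrak g$, $(x,y,z)$ for elements of $\mathfrak h$, $(x,y)$ for elements of the abelian Lie algebra $\mathfrak h/\mathfrak z$, and $r\in\mathbb R$ for elements of $\mathfrak g/\mathfrak q$. The differential $d\phi(p,q,r)$ of $\phi\in C^\infty(\mathfrak g)$ is viewed as an element of $\mathfrak g^*=\mathfrak h$. The canonical inclusion $V\subseteq C^\infty(\mathfrak g)$ is by pull-back along the projection $\mathfrak g\to\mathfrak g/\mathfrak q$, and $\mathfrak h$ is viewed in $C^\infty(\mathfrak g)$ as the linear functions on $\mathfrak g=\mathfrak h^*$. The sum in (2) means $\{\phi,\psi\}(\mu)=\langle[\dot{d\phi(\mu)},\dot{d\psi(\mu)}]_{\mathfrak h/\mathfrak z},\cdot\rangle+\omega(\dot{d\phi(\mu)},\dot{d\psi(\mu)};\dot\mu)$,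 where dots denote classes in $\mathfrak h/\mathfrak z$ and in $\mathfrak g/\mathfrak q$ respectively, and the first term is the linear Poisson bracket of $(\mathfrak h/\mathfrak z)^*$ (zero here). The linear Poisson bracket on $\mathfrak h^*$ is $\{\phi,\psi\}_{lin}(\mu)=\langle[d\phi(\mu),d\psi(\mu)],\mu\rangle$. A Poisson bracket on $\mathfrak h^*$ is called a cocycle perturbation of it if it has the form $\{\phi,\psi\}(\mu)=\{\phi,\psi\}_{lin}(\mu)+\Omega(\dot{d\phi(\mu)},\dot{d\psi(\mu)};\dot\mu)$ for some Lie algebra 2-cocycle $\Omega$ of $\mathfrak h/\mathfrak z$ with values in the trivial module $V$. *)

theory Defs
  imports "HOL-Analysis.Analysis"
begin

section \<open>Smooth functions and Poisson brackets\<close>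

text \<open>A function on a Euclidean space is \<open>C\<^sup>k\<^sup>+\<^sup>1\<close> iff it is differentiable everywhere and all its
  directional derivatives are \<open>C\<^sup>k\<close>.\<close>

primrec Ck :: "nat \<Rightarrow> ('a::euclidean_space \<Rightarrow> real) \<Rightarrow> bool" where
  "Ck 0 f \<longleftrightarrow> continuous_on UNIV f"
| "Ck (Suc k) f \<longleftrightarrow>
     (\<forall>x. f differentiable (at x)) \<and> (\<forall>v. Ck k (\<lambda>x. frechet_derivative f (at x) v))"

definition smooth_functions :: "('a::euclidean_space \<Rightarrow> real) set" where
  "smooth_functions = {f. \<forall>k. Ck k f}"

locale poisson_bracket =
  fixes B :: "('a::euclidean_space \<Rightarrow> real) \<Rightarrow> ('a \<Rightarrow> real) \<Rightarrow> ('a \<Rightarrow> real)"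
  assumes closed: "\<lbrakk>f \<in> smooth_functions; g \<in> smooth_functions\<rbrakk> \<Longrightarrow> B f g \<in> smooth_functions"
    and linear_left: "\<lbrakk>f \<in> smooth_functions; g \<in> smooth_functions; h \<in> smooth_functions\<rbrakk> \<Longrightarrow>
      B (\<lambda>x. a * f x + b * g x) h = (\<lambda>x. a * B f h x + b * B g h x)"
    and antisymmetric: "\<lbrakk>f \<in> smooth_functions; g \<in> smooth_functions\<rbrakk> \<Longrightarrow> B f g = (\<lambda>x. - B g f x)"
    and leibniz: "\<lbrakk>f \<in> smooth_functions; g \<in> smooth_functions; h \<in> smooth_functions\<rbrakk> \<Longrightarrow>
      B f (\<lambda>x. g x * h x) = (\<lambda>x. B f g x * h x + g x * B f h x)"
    and jacobi: "\<lbrakk>f \<in> smooth_functions; g \<in> smooth_functions; h \<in> smooth_functions\<rbrakk> \<Longrightarrow>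
      B f (B g h) x + B g (B h f) x + B h (B f g) x = 0"


section \<open>Lie algebra cocycles with values in a space of functions\<close>

locale lie_algebra =
  fixes br :: "'a::real_vector \<Rightarrow> 'a \<Rightarrow> 'a"
  assumes bilinear_br: "bilinear br"
    and br_self: "br X X = 0"
    and jacobi: "br X (br Y Z) + br Y (br Z X) + br Z (br X Y) = 0"

definition lie_center :: "('a::real_vector \<Rightarrow> 'a \<Rightarrow> 'a) \<Rightarrow> 'a set" where
  "lie_center br = {X. \<forall>Y. br X Y = 0}"

definition function_space :: "('b \<Rightarrow> real) set \<Rightarrow> bool" where
  "function_space V \<longleftrightarrow>
     (\<lambda>_. 0) \<in> V \<and> (\<forall>f\<in>V. \<forall>g\<in>V. \<forall>a b. (\<lambda>t. a * f t + b * g t) \<in> V)"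

text \<open>Modules over the universal enveloping algebra are the same thing as modules over the
  Lie algebra. The module is a space \<open>V\<close> of real-valued functions with pointwise operations.\<close>

locale lie_module = lie_algebra br
  for br :: "'a::real_vector \<Rightarrow> 'a \<Rightarrow> 'a" +
  fixes V :: "('b \<Rightarrow> real) set"
    and act :: "'a \<Rightarrow> ('b \<Rightarrow> real) \<Rightarrow> ('b \<Rightarrow> real)"
  assumes function_space: "function_space V"
    and act_closed: "f \<in> V \<Longrightarrow> act X f \<in> V"
    and act_linear_left: "f \<in> V \<Longrightarrow>
      act (a *\<^sub>R X + b *\<^sub>R Y) f = (\<lambda>t. a * act X f t + b * act Y f t)"
    and act_linear_right: "\<lbrakk>f \<in> V; g \<in> V\<rbrakk> \<Longrightarrow>
      act X (\<lambda>t. a * f t + b * g t) = (\<lambda>t. a * act X f t + b * act X g t)"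
    and act_br: "f \<in> V \<Longrightarrow> act (br X Y) f = (\<lambda>t. act X (act Y f) t - act Y (act X f) t)"

definition trivial_action :: "'a \<Rightarrow> ('b \<Rightarrow> real) \<Rightarrow> ('b \<Rightarrow> real)" where
  "trivial_action X f = (\<lambda>_. 0)"

text \<open>The last axiom is the vanishing of the Chevalley--Eilenberg differential.\<close>

locale lie_cocycle2 = lie_module br V act
  for br :: "'a::real_vector \<Rightarrow> 'a \<Rightarrow> 'a"
    and V :: "('b \<Rightarrow> real) set"
    and act :: "'a \<Rightarrow> ('b \<Rightarrow> real) \<Rightarrow> ('b \<Rightarrow> real)" +
  fixes \<omega> :: "'a \<Rightarrow> 'a \<Rightarrow> ('b \<Rightarrow> real)"
  assumes omega_in: "\<omega> X Y \<in> V"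
    and bilinear_omega: "bilinear (\<lambda>X Y. \<omega> X Y t)"
    and alternating: "\<omega> X X t = 0"
    and cocycle: "act X (\<omega> Y Z) t - act Y (\<omega> X Z) t + act Z (\<omega> X Y) t
      - \<omega> (br X Y) Z t + \<omega> (br X Z) Y t - \<omega> (br Y Z) X t = 0"


section \<open>The Heisenberg Lie algebra, its dual and its quotients\<close>

text \<open>Everything is written in coordinates; the dimension \<open>n\<close> is \<open>CARD('n)\<close>. The element
  \<open>(x, y, z)\<close> of \<open>\<hh>\<close> is \<open>\<Sum>i. x\<^sub>i \<^bold>x\<^sub>i + y\<^sub>i \<^bold>y\<^sub>i + z \<^bold>z\<close>, and \<open>(p, q, r)\<close> are the coordinates of an
  element of \<open>\<gg> = \<hh>\<^sup>*\<close> with respect to the dual basis. The lemmas below justify the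
  identifications.\<close>

type_synonym 'n heis = "(real^'n) \<times> (real^'n) \<times> real"
type_synonym 'n heis_dual = "(real^'n) \<times> (real^'n) \<times> real"

text \<open>\<open>\<hh>/\<zz>\<close>, its dual, and \<open>\<gg>/\<qq>\<close>.\<close>

type_synonym 'n hz = "(real^'n) \<times> (real^'n)"
type_synonym 'n hz_dual = "(real^'n) \<times> (real^'n)"
type_synonym gq = real

fun heis_bracket :: "'n::finite heis \<Rightarrow> 'n heis \<Rightarrow> 'n heis" where
  "heis_bracket (x, y, z) (x', y', z') = (0, 0, x \<bullet> y' - x' \<bullet> y)"

fun pairing :: "'n::finite heis \<Rightarrow> 'n heis_dual \<Rightarrow> real" where
  "pairing (x, y, z) (p, q, r) = x \<bullet> p + y \<bullet> q + z * r"

fun hmod :: "'n heis \<Rightarrow> 'n hz" where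
  "hmod (x, y, z) = (x, y)"

fun gmod :: "'n heis_dual \<Rightarrow> gq" where
  "gmod (p, q, r) = r"

text \<open>The bracket induced on \<open>\<hh>/\<zz>\<close>, computed on the representatives \<open>(x, y, 0)\<close>.\<close>

fun hz_bracket :: "'n::finite hz \<Rightarrow> 'n hz \<Rightarrow> 'n hz" where
  "hz_bracket (x, y) (x', y') = hmod (heis_bracket (x, y, 0) (x', y', 0))"

fun hz_pairing :: "'n::finite hz \<Rightarrow> 'n hz_dual \<Rightarrow> real" where
  "hz_pairing (x, y) (p, q) = x \<bullet> p + y \<bullet> q"

text \<open>The component in \<open>(\<hh>/\<zz>)\<^sup>* = \<qq>\<close> of an element of \<open>\<gg>\<close>, with respect to the decomposition
  given by the dual basis.\<close>

fun hz_dual_part :: "'n heis_dual \<Rightarrow> 'n hz_dual" where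
  "hz_dual_part (p, q, r) = (p, q)"

text \<open>The space \<open>\<qq> = \<zz>\<^sup>\<bottom>\<close>.\<close>

definition annihilator :: "'n::finite heis set \<Rightarrow> 'n heis_dual set" where
  "annihilator S = {\<mu>. \<forall>X\<in>S. pairing X \<mu> = 0}"

lemma lie_algebra_heis: "lie_algebra (heis_bracket :: 'n::finite heis \<Rightarrow> _)"
  by unfold_locales
    (auto simp: bilinear_def linear_iff inner_add_left inner_add_right algebra_simps zero_prod_def)

lemma heis_bracket_basis:
  fixes i j :: "'n::finite"
  shows "heis_bracket (axis i 1, 0, 0) (0, axis j 1, 0) = (0, 0, if i = j then 1 else 0)"
    and "heis_bracket (axis i 1, 0, 0) (axis j 1, 0, 0) = 0"
    and "heis_bracket (0, axis i 1, 0) (0, axis j 1, 0) = 0"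
    and "heis_bracket (0, 0, 1) (X :: 'n heis) = 0"
  by (auto simp: inner_axis_axis zero_prod_def) (cases X; simp add: zero_prod_def)

lemma heis_center: "lie_center heis_bracket = range (\<lambda>z. (0 :: real^'n::finite, 0 :: real^'n, z))"
proof -
  have "x = 0 \<and> y = 0" if "\<forall>x' y'. x \<bullet> y' - x' \<bullet> y = 0" for x y :: "real^'n"
    using that[rule_format, of x 0] that[rule_format, of 0 y] by simp
  then show ?thesis
    by (auto simp: lie_center_def zero_prod_def)
qed

text \<open>\<open>\<gg>\<close> is the space of all linear functionals on \<open>\<hh>\<close>, and likewise for \<open>\<hh>/\<zz>\<close>.\<close>

lemma pairing_inner: "pairing X \<mu> = X \<bullet> \<mu>"
  by (cases X; cases \<mu>) simp

lemma pairing_dual: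
  fixes f :: "'n::finite heis \<Rightarrow> real"
  assumes "linear f"
  shows "\<exists>!\<mu>. \<forall>X. f X = pairing X \<mu>"
proof -
  have "f X = pairing X (adjoint f 1)" for X
    using adjoint_works[OF assms, of X 1] by (simp add: pairing_inner)
  then show ?thesis
    unfolding pairing_inner by (metis vector_eq_ldot)
qed

lemma hz_pairing_inner: "hz_pairing A \<nu> = A \<bullet> \<nu>"
  by (cases A; cases \<nu>) simp

lemma hz_pairing_dual:
  fixes f :: "'n::finite hz \<Rightarrow> real"
  assumes "linear f"
  shows "\<exists>!\<nu>. \<forall>A. f A = hz_pairing A \<nu>"
proof -
  have "f A = hz_pairing A (adjoint f 1)" for A
    using adjoint_works[OF assms, of A 1] by (simp add: hz_pairing_inner)
  then show ?thesis
    unfolding hz_pairing_inner by (metis vector_eq_ldot)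
qed

text \<open>\<open>hmod\<close> and \<open>gmod\<close> are the quotient maps by \<open>\<zz>\<close> and by \<open>\<qq>\<close>.\<close>

lemma hmod_quotient:
  shows "linear (hmod :: 'n::finite heis \<Rightarrow> _)" and "surj (hmod :: 'n heis \<Rightarrow> _)"
    and "hmod (X :: 'n heis) = 0 \<longleftrightarrow> X \<in> lie_center heis_bracket"
    and "hmod (heis_bracket X Y) = hz_bracket (hmod X) (hmod Y)"
proof -
  show "linear (hmod :: 'n heis \<Rightarrow> _)"
    by (rule linearI) (auto simp: split_paired_all)
  show "surj (hmod :: 'n heis \<Rightarrow> _)"
    by (rule surjI[of _ "\<lambda>(x, y). (x, y, 0)"]) (simp add: split_paired_all)
  show "hmod X = 0 \<longleftrightarrow> X \<in> lie_center heis_bracket"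
    by (cases X) (auto simp: heis_center zero_prod_def)
  show "hmod (heis_bracket X Y) = hz_bracket (hmod X) (hmod Y)"
    by (cases X; cases Y) simp
qed

lemma gmod_quotient:
  shows "linear (gmod :: 'n::finite heis_dual \<Rightarrow> _)" and "surj (gmod :: 'n heis_dual \<Rightarrow> _)"
    and "gmod (\<mu> :: 'n heis_dual) = 0 \<longleftrightarrow> \<mu> \<in> annihilator (lie_center heis_bracket)"
proof -
  show "linear (gmod :: 'n heis_dual \<Rightarrow> _)"
    by (rule linearI) (auto simp: split_paired_all)
  show "surj (gmod :: 'n heis_dual \<Rightarrow> _)"
    by (rule surjI[of _ "\<lambda>r. (0, 0, r)"]) simp
  have "(\<forall>z. z * r = 0) \<longleftrightarrow> r = 0" for r :: real
    by (metis mult_1 mult_zero_right)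
  then show "gmod \<mu> = 0 \<longleftrightarrow> \<mu> \<in> annihilator (lie_center heis_bracket)"
    by (cases \<mu>) (simp add: heis_center annihilator_def)
qed


section \<open>The Poisson brackets\<close>

definition differential :: "('n::finite heis_dual \<Rightarrow> real) \<Rightarrow> 'n heis_dual \<Rightarrow> 'n heis" where
  "differential \<phi> \<mu> = (THE X. (\<phi> has_derivative pairing X) (at \<mu>))"

lemma has_derivative_differential:
  fixes \<phi> :: "'n::finite heis_dual \<Rightarrow> real"
  assumes "\<phi> differentiable (at \<mu>)"
  shows "(\<phi> has_derivative pairing (differential \<phi> \<mu>)) (at \<mu>)"
proof -
  obtain D where D: "(\<phi> has_derivative D) (at \<mu>)"
    using assms by (auto simp: differentiable_def)
  have lin: "linear D"
    using D by (rule has_derivative_linear)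
  have eq: "D = pairing (adjoint D 1)"
    using adjoint_works[OF lin, of _ 1] by (auto simp: pairing_inner inner_commute fun_eq_iff)
  have "\<exists>!X. (\<phi> has_derivative pairing X) (at \<mu>)"
  proof (rule ex1I)
    show "(\<phi> has_derivative pairing (adjoint D 1)) (at \<mu>)"
      using D eq by simp
  next
    fix X assume "(\<phi> has_derivative pairing X) (at \<mu>)"
    then have "pairing X = pairing (adjoint D 1)"
      using D eq has_derivative_unique by metis
    then show "X = adjoint D 1"
      by (simp add: fun_eq_iff pairing_inner vector_eq_rdot del: split_paired_All)
  qed
  then show ?thesis
    unfolding differential_def by (rule theI')
qed

definition eta :: "real \<Rightarrow> real \<Rightarrow> real" where
  "eta lam r = (exp (2 * lam * r) - 1) / (2 * lam)"

fun heis_omega :: "real \<Rightarrow> 'n::finite hz \<Rightarrow> 'n hz \<Rightarrow> (gq \<Rightarrow> real)" where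
  "heis_omega lam (x, y) (x', y') = (\<lambda>r. eta lam r * (x \<bullet> y' - x' \<bullet> y))"

definition heis_poisson ::
    "real \<Rightarrow> ('n::finite heis_dual \<Rightarrow> real) \<Rightarrow> ('n heis_dual \<Rightarrow> real) \<Rightarrow> ('n heis_dual \<Rightarrow> real)" where
  "heis_poisson lam \<phi> \<psi> = (\<lambda>(p, q, r).
     let (x, y, z) = differential \<phi> (p, q, r);
         (x', y', z') = differential \<psi> (p, q, r)
     in (exp (2 * lam * r) - 1) / (2 * lam) * (x \<bullet> y' - x' \<bullet> y))"

definition linear_poisson ::
    "('n::finite heis_dual \<Rightarrow> real) \<Rightarrow> ('n heis_dual \<Rightarrow> real) \<Rightarrow> ('n heis_dual \<Rightarrow> real)" where
  "linear_poisson \<phi> \<psi> = (\<lambda>\<mu>. pairing (heis_bracket (differential \<phi> \<mu>) (differential \<psi> \<mu>)) \<mu>)"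

definition cocycle_perturbation ::
    "(('n::finite heis_dual \<Rightarrow> real) \<Rightarrow> ('n heis_dual \<Rightarrow> real) \<Rightarrow> ('n heis_dual \<Rightarrow> real)) \<Rightarrow> bool" where
  "cocycle_perturbation B \<longleftrightarrow> poisson_bracket B \<and>
     (\<exists>\<Omega> :: 'n hz \<Rightarrow> 'n hz \<Rightarrow> (gq \<Rightarrow> real).
        lie_cocycle2 hz_bracket smooth_functions trivial_action \<Omega> \<and>
        (\<forall>\<phi>\<in>smooth_functions. \<forall>\<psi>\<in>smooth_functions. \<forall>\<mu>.
           B \<phi> \<psi> \<mu> = linear_poisson \<phi> \<psi> \<mu>
             + \<Omega> (hmod (differential \<phi> \<mu>)) (hmod (differential \<psi> \<mu>)) (gmod \<mu>)))"

text \<open>The inclusions of \<open>V\<close> and of \<open>\<hh>\<close> into the functions on \<open>\<gg>\<close>.\<close>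

definition pullback :: "(gq \<Rightarrow> real) \<Rightarrow> ('n heis_dual \<Rightarrow> real)" where
  "pullback f = f \<circ> gmod"

definition linear_function :: "'n::finite heis \<Rightarrow> ('n heis_dual \<Rightarrow> real)" where
  "linear_function X = (\<lambda>\<mu>. pairing X \<mu>)"

definition linear_embedding ::
    "('a \<Rightarrow> real) set \<Rightarrow> ('b \<Rightarrow> real) set \<Rightarrow> (('a \<Rightarrow> real) \<Rightarrow> ('b \<Rightarrow> real)) \<Rightarrow> bool" where
  "linear_embedding V W F \<longleftrightarrow> F ` V \<subseteq> W \<and> inj_on F V \<and>
     (\<forall>f\<in>V. \<forall>g\<in>V. \<forall>a b. F (\<lambda>t. a * f t + b * g t) = (\<lambda>t. a * F f t + b * F g t))"

lemma linear_function_embedding: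
  "inj linear_function"
  "linear_function (a *\<^sub>R X + b *\<^sub>R Y) = (\<lambda>\<mu>. a * linear_function X \<mu> + b * linear_function Y \<mu>)"
  by (rule injI)
    (simp_all add: linear_function_def pairing_inner inner_add_left fun_eq_iff vector_eq_rdot
      del: split_paired_All)

end

theory Submission
  imports Defs
begin

text \<open>For a skew map \<open>J\<close> and a function \<open>e\<close> that is constant along the image of \<open>J\<close>, the bracket
  \<open>e \<langle>J\<nabla>f, \<nabla>g\<rangle>\<close> is Poisson: writing \<open>X\<^sub>f = J\<nabla>f\<close>, one has
  \<open>{f, {g, h}} = e\<^sup>2 (Hess h (X\<^sub>f, X\<^sub>g) - Hess g (X\<^sub>f, X\<^sub>h))\<close>, and the cyclic sum cancels because
  Hessians are symmetric. Here \<open>J(x, y, z) = (-y, x, 0)\<close> and \<open>e = \<eta>\<^sub>\<lambda>(r)\<close>. The linear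
  bracket is the one with \<open>e = r\<close>, so the perturbing cocycle has coefficient \<open>\<eta>\<^sub>\<lambda>(r) - r\<close>.\<close>

section \<open>Directional derivatives of smooth functions\<close>

text \<open>The direction comes first so that \<open>dir_deriv v\<close> is an operator on
  functions: it can be iterated, and smooth functions are closed under it.\<close>

definition dir_deriv :: "'a::euclidean_space \<Rightarrow> ('a \<Rightarrow> real) \<Rightarrow> 'a \<Rightarrow> real" where
  "dir_deriv v f x = frechet_derivative f (at x) v"

lemma Ck_Suc_iff:
  "Ck (Suc k) f \<longleftrightarrow> (\<forall>x. f differentiable (at x)) \<and> (\<forall>v. Ck k (dir_deriv v f))"
  by (simp add: dir_deriv_def[abs_def])

lemma dir_deriv_eqI: "(f has_derivative f') (at x) \<Longrightarrow> dir_deriv v f x = f' v"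
  unfolding dir_deriv_def using frechet_derivative_at by metis

lemma has_derivative_dir_deriv:
  "f differentiable (at x) \<Longrightarrow> (f has_derivative (\<lambda>v. dir_deriv v f x)) (at x)"
  using frechet_derivative_works[of f "at x"] by (simp add: dir_deriv_def)

lemma linear_dir_deriv: "f differentiable (at x) \<Longrightarrow> linear (\<lambda>v. dir_deriv v f x)"
  using has_derivative_dir_deriv has_derivative_linear by blast

lemma dir_deriv_linear_combination:
  assumes "f differentiable (at x)" "g differentiable (at x)"
  shows "dir_deriv v (\<lambda>x. a * f x + b * g x) x = a * dir_deriv v f x + b * dir_deriv v g x"
  by (rule dir_deriv_eqI)
    (auto intro!: derivative_eq_intros has_derivative_dir_deriv assms)

lemma dir_deriv_mult:
  assumes "f differentiable (at x)" "g differentiable (at x)"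
  shows "dir_deriv v (\<lambda>x. f x * g x) x = dir_deriv v f x * g x + f x * dir_deriv v g x"
  by (rule dir_deriv_eqI)
    (auto intro!: derivative_eq_intros has_derivative_dir_deriv assms)

lemma dir_deriv_sum:
  assumes "\<And>i. i \<in> I \<Longrightarrow> f i differentiable (at x)"
  shows "dir_deriv v (\<lambda>x. \<Sum>i\<in>I. f i x) x = (\<Sum>i\<in>I. dir_deriv v (f i) x)"
  by (rule dir_deriv_eqI)
    (auto intro!: derivative_eq_intros has_derivative_dir_deriv assms)

lemma dir_deriv_compose_linear:
  assumes "linear L" "f differentiable (at (L x))"
  shows "dir_deriv v (\<lambda>x. f (L x)) x = dir_deriv (L v) f (L x)"
  by (rule dir_deriv_eqI)
    (rule has_derivative_compose[OF linear_imp_has_derivative[OF assms(1)]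
      has_derivative_dir_deriv[OF assms(2)]])

section \<open>Closure properties of the classes \<open>Ck k\<close>\<close>

lemma Ck_SucD: "Ck (Suc k) f \<Longrightarrow> Ck k f"
proof (induction k arbitrary: f)
  case 0
  then show ?case
    by (auto simp: continuous_on_eq_continuous_at differentiable_imp_continuous_within)
next
  case (Suc k)
  then show ?case
    unfolding Ck_Suc_iff[of "Suc k"] Ck_Suc_iff[of k] by blast
qed

lemma Ck_const: "Ck k (\<lambda>_. c)"
  by (induction k arbitrary: c) auto

lemma Ck_linear: "linear f \<Longrightarrow> Ck k f"
proof (induction k arbitrary: f)
  case 0
  then show ?case
    by (simp add: linear_continuous_on linear_linear)
next
  case (Suc k)
  have "dir_deriv v f = (\<lambda>_. f v)" for v
    using dir_deriv_eqI[OF linear_imp_has_derivative[OF Suc.prems]] by blast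
  then show ?case
    using linear_imp_differentiable[OF Suc.prems] by (simp add: Ck_Suc_iff Ck_const del: Ck.simps(2))
qed

lemma Ck_linear_combination:
  "\<lbrakk>Ck k f; Ck k g\<rbrakk> \<Longrightarrow> Ck k (\<lambda>x. a * f x + b * g x)"
proof (induction k arbitrary: f g)
  case 0
  then show ?case
    by (simp add: continuous_on_add continuous_on_mult_left)
next
  case (Suc k)
  then have "dir_deriv v (\<lambda>x. a * f x + b * g x) = (\<lambda>x. a * dir_deriv v f x + b * dir_deriv v g x)"
    for v
    by (auto simp: dir_deriv_linear_combination)
  with Suc show ?case
    by (auto simp: Ck_Suc_iff simp del: Ck.simps(2) intro!: derivative_intros)
qed

text \<open>The product rule turns a derivative of the product into products of one derivative with
  one undifferentiated factor. The latter has to be brought down to class \<open>k\<close> by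
  \<open>Ck_SucD\<close> before the induction hypothesis applies.\<close>

lemma Ck_mult: "\<lbrakk>Ck k f; Ck k g\<rbrakk> \<Longrightarrow> Ck k (\<lambda>x. f x * g x)"
proof (induction k arbitrary: f g)
  case 0
  then show ?case
    by (simp add: continuous_on_mult)
next
  case (Suc k)
  \<comment> \<open>The factors 1 give the right-hand side the shape of
    \<open>Ck_linear_combination\<close>.\<close>
  have D: "dir_deriv v (\<lambda>x. f x * g x)
      = (\<lambda>x. 1 * (dir_deriv v f x * g x) + 1 * (f x * dir_deriv v g x))" for v
    using Suc.prems by (auto simp: dir_deriv_mult)
  have "Ck k f" "Ck k g" "Ck k (dir_deriv v f)" "Ck k (dir_deriv v g)" for v
    using Suc.prems Ck_SucD by (auto simp: Ck_Suc_iff simp del: Ck.simps(2))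
  then have "Ck k (dir_deriv v (\<lambda>x. f x * g x))" for v
    unfolding D by (intro Ck_linear_combination Suc.IH)
  with Suc.prems show ?case
    by (auto simp: Ck_Suc_iff simp del: Ck.simps(2) intro!: derivative_intros)
qed

lemma Ck_compose_linear:
  assumes "linear L"
  shows "Ck k f \<Longrightarrow> Ck k (\<lambda>x. f (L x))"
proof (induction k arbitrary: f)
  case 0
  then show ?case
    using assms continuous_on_compose2[of UNIV f UNIV L]
    by (simp add: linear_continuous_on linear_linear)
next
  case (Suc k)
  then have "dir_deriv v (\<lambda>x. f (L x)) = (\<lambda>x. dir_deriv (L v) f (L x))" for v
    using assms by (auto simp: dir_deriv_compose_linear)
  moreover have "(\<lambda>x. f (L x)) differentiable (at x)" for x
    using Suc.prems differentiable_compose[of f L x UNIV] linear_imp_differentiable[OF assms]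
    by auto
  ultimately show ?case
    using Suc by (auto simp: Ck_Suc_iff simp del: Ck.simps(2))
qed

text \<open>Differentiating in direction \<open>v\<close> only replaces the coefficient
  \<open>a\<close> by \<open>a * c * v\<close>, so the induction closes once \<open>a\<close> is
  generalized.\<close>

lemma Ck_exp: "Ck k (\<lambda>r::real. a * exp (c * r))"
proof (induction k arbitrary: a)
  case 0
  then show ?case
    by (auto intro!: continuous_intros)
next
  case (Suc k)
  have D: "((\<lambda>r. a * exp (c * r)) has_derivative (\<lambda>v. a * c * v * exp (c * r))) (at r)" for r
    by (auto intro!: derivative_eq_intros)
  have "dir_deriv v (\<lambda>r. a * exp (c * r)) = (\<lambda>r. a * c * v * exp (c * r))" for v
    using dir_deriv_eqI[OF D] by blast
  with Suc D show ?case
    by (auto simp: Ck_Suc_iff differentiable_def simp del: Ck.simps(2))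
qed

section \<open>The same closure properties for smooth functions\<close>

lemma smooth_dir_deriv: "f \<in> smooth_functions \<Longrightarrow> dir_deriv v f \<in> smooth_functions"
  unfolding smooth_functions_def using Ck_Suc_iff by blast

lemma smooth_differentiable: "f \<in> smooth_functions \<Longrightarrow> f differentiable (at x)"
  unfolding smooth_functions_def using Ck_Suc_iff by blast

lemma smooth_continuous: "f \<in> smooth_functions \<Longrightarrow> continuous_on UNIV f"
  unfolding smooth_functions_def using Ck.simps(1) by blast

lemma smooth_const: "(\<lambda>_. c) \<in> smooth_functions"
  by (simp add: smooth_functions_def Ck_const del: Ck.simps)

lemma smooth_linear: "linear f \<Longrightarrow> f \<in> smooth_functions"
  by (simp add: smooth_functions_def Ck_linear del: Ck.simps)

lemma smooth_linear_combination:
  "\<lbrakk>f \<in> smooth_functions; g \<in> smooth_functions\<rbrakk> \<Longrightarrow> (\<lambda>x. a * f x + b * g x) \<in> smooth_functions"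
  by (simp add: smooth_functions_def Ck_linear_combination del: Ck.simps)

lemma smooth_mult:
  "\<lbrakk>f \<in> smooth_functions; g \<in> smooth_functions\<rbrakk> \<Longrightarrow> (\<lambda>x. f x * g x) \<in> smooth_functions"
  by (simp add: smooth_functions_def Ck_mult del: Ck.simps)

lemma smooth_compose_linear:
  "\<lbrakk>linear L; f \<in> smooth_functions\<rbrakk> \<Longrightarrow> (\<lambda>x. f (L x)) \<in> smooth_functions"
  by (simp add: smooth_functions_def Ck_compose_linear del: Ck.simps)

lemma smooth_sum:
  "(\<And>i. i \<in> I \<Longrightarrow> f i \<in> smooth_functions) \<Longrightarrow> (\<lambda>x. \<Sum>i\<in>I. f i x) \<in> smooth_functions"
proof (induction I rule: infinite_finite_induct)
  case (insert i I)
  then show ?case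
    using smooth_linear_combination[of "f i" "\<lambda>x. \<Sum>i\<in>I. f i x" 1 1] by simp
qed (simp_all add: smooth_const)

section \<open>Symmetry of second derivatives\<close>

text \<open>The mean value theorem is used twice: along \<open>u\<close> for the difference of
  \<open>f\<close> on two parallel segments, then along \<open>v\<close> for
  \<open>dir_deriv u f\<close>. The left-hand side is symmetric in \<open>u\<close> and
  \<open>v\<close>, which is what yields the symmetry of mixed derivatives.\<close>

lemma second_difference_mvt:
  fixes f :: "'a::euclidean_space \<Rightarrow> real"
  assumes f: "\<And>y. f differentiable (at y)" and f': "\<And>y. dir_deriv u f differentiable (at y)"
    and "0 < h"
  obtains s t where "0 < s" "s < h" "0 < t" "t < h"
    "f (x + h *\<^sub>R u + h *\<^sub>R v) - f (x + h *\<^sub>R u) - f (x + h *\<^sub>R v) + f x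
      = h\<^sup>2 * dir_deriv v (dir_deriv u f) (x + s *\<^sub>R u + t *\<^sub>R v)"
proof -
  \<comment> \<open>Chain rule along a line; linearity in the direction pulls out the scalar
    \<open>d\<close>.\<close>
  have line: "((\<lambda>s. g (y + s *\<^sub>R w)) has_derivative (\<lambda>d. d * dir_deriv w g (y + s *\<^sub>R w)))
      (at s within S)"
    if "\<And>y. g differentiable (at y)" for g :: "'a \<Rightarrow> real" and y w s S
  proof -
    have "((\<lambda>s. y + s *\<^sub>R w) has_derivative (\<lambda>d. d *\<^sub>R w)) (at s within S)"
      by (auto intro!: derivative_eq_intros)
    from has_derivative_compose[OF this has_derivative_dir_deriv[OF that]]
    show ?thesis
      by (simp add: linear_cmul[OF linear_dir_deriv[OF that]])
  qed
  have swap: "y + s *\<^sub>R u + t *\<^sub>R v = y + t *\<^sub>R v + s *\<^sub>R u" for y s t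
    by (simp add: algebra_simps)
  \<comment> \<open>The terms with \<open>0\<close> spell out the endpoint 0 of the interval, as
    \<open>mvt_simple\<close> produces them.\<close>
  have "\<exists>s\<in>{0<..<h}. (f (x + h *\<^sub>R v + h *\<^sub>R u) - f (x + h *\<^sub>R u))
      - (f (x + h *\<^sub>R v + 0 *\<^sub>R u) - f (x + 0 *\<^sub>R u))
    = (h - 0) * dir_deriv u f (x + h *\<^sub>R v + s *\<^sub>R u) - (h - 0) * dir_deriv u f (x + s *\<^sub>R u)"
    using \<open>0 < h\<close> by (intro mvt_simple has_derivative_diff line f)
  then obtain s where s: "0 < s" "s < h"
    "f (x + h *\<^sub>R u + h *\<^sub>R v) - f (x + h *\<^sub>R u) - f (x + h *\<^sub>R v) + f x
      = h * (dir_deriv u f (x + s *\<^sub>R u + h *\<^sub>R v) - dir_deriv u f (x + s *\<^sub>R u))"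
    by (auto simp: swap algebra_simps)
  have "\<exists>t\<in>{0<..<h}. dir_deriv u f (x + s *\<^sub>R u + h *\<^sub>R v) - dir_deriv u f (x + s *\<^sub>R u + 0 *\<^sub>R v)
    = (h - 0) * dir_deriv v (dir_deriv u f) (x + s *\<^sub>R u + t *\<^sub>R v)"
    using \<open>0 < h\<close> by (intro mvt_simple line f')
  with s that show thesis
    by (auto simp: power2_eq_square)
qed

text \<open>Expanding one second difference in both orders makes the two mixed derivatives agree at
  two points near \<open>x\<close>. Both points tend to \<open>x\<close> as the step
  \<open>h\<close> shrinks, and the mixed derivatives are continuous.\<close>

lemma dir_deriv_commute:
  fixes f :: "'a::euclidean_space \<Rightarrow> real"
  assumes "f \<in> smooth_functions"
  shows "dir_deriv u (dir_deriv v f) x = dir_deriv v (dir_deriv u f) x"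
proof -
  note smooth = smooth_dir_deriv[OF assms]
  let ?h = "\<lambda>n. 1 / real (Suc n)"
  have limit: "(\<lambda>n. dir_deriv b (dir_deriv a f) (x + s n *\<^sub>R a + t n *\<^sub>R b))
      \<longlonglongrightarrow> dir_deriv b (dir_deriv a f) x"
    if "\<And>n. 0 < s n \<and> s n < ?h n \<and> 0 < t n \<and> t n < ?h n" for s t a b
  proof -
    \<comment> \<open>The offsets are squeezed between 0 and
      \<open>1 / real (Suc n)\<close>.\<close>
    have "s \<longlonglongrightarrow> 0" "t \<longlonglongrightarrow> 0"
      using that by (auto intro!: tendsto_sandwich[OF _ _ tendsto_const LIMSEQ_Suc[OF lim_1_over_n]]
        always_eventually less_imp_le)
    then have "(\<lambda>n. x + s n *\<^sub>R a + t n *\<^sub>R b) \<longlonglongrightarrow> x + 0 *\<^sub>R a + 0 *\<^sub>R b"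
      by (intro tendsto_intros)
    then show ?thesis
      using continuous_on_tendsto_compose[OF smooth_continuous[OF smooth_dir_deriv[OF smooth]]]
      by simp
  qed
  have "\<exists>s t s' t'. (0 < s \<and> s < h \<and> 0 < t \<and> t < h) \<and> (0 < s' \<and> s' < h \<and> 0 < t' \<and> t' < h) \<and>
      dir_deriv v (dir_deriv u f) (x + s *\<^sub>R u + t *\<^sub>R v)
        = dir_deriv u (dir_deriv v f) (x + s' *\<^sub>R v + t' *\<^sub>R u)" if "0 < h" for h
  proof -
    note mvt = second_difference_mvt[OF smooth_differentiable[OF assms]
        smooth_differentiable[OF smooth] \<open>0 < h\<close>, of x]
    obtain s t where st: "0 < s" "s < h" "0 < t" "t < h"
      "f (x + h *\<^sub>R u + h *\<^sub>R v) - f (x + h *\<^sub>R u) - f (x + h *\<^sub>R v) + f x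
        = h\<^sup>2 * dir_deriv v (dir_deriv u f) (x + s *\<^sub>R u + t *\<^sub>R v)"
      by (rule mvt[of u v])
    obtain s' t' where st': "0 < s'" "s' < h" "0 < t'" "t' < h"
      "f (x + h *\<^sub>R v + h *\<^sub>R u) - f (x + h *\<^sub>R v) - f (x + h *\<^sub>R u) + f x
        = h\<^sup>2 * dir_deriv u (dir_deriv v f) (x + s' *\<^sub>R v + t' *\<^sub>R u)"
      by (rule mvt[of v u])
    have "f (x + h *\<^sub>R u + h *\<^sub>R v) - f (x + h *\<^sub>R u) - f (x + h *\<^sub>R v) + f x
        = f (x + h *\<^sub>R v + h *\<^sub>R u) - f (x + h *\<^sub>R v) - f (x + h *\<^sub>R u) + f x"
      by (simp add: algebra_simps)
    then have "dir_deriv v (dir_deriv u f) (x + s *\<^sub>R u + t *\<^sub>R v)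
        = dir_deriv u (dir_deriv v f) (x + s' *\<^sub>R v + t' *\<^sub>R u)"
      unfolding st(5) st'(5) using \<open>0 < h\<close> by simp
    with st(1-4) st'(1-4) show ?thesis
      by blast
  qed
  \<comment> \<open>Choosing the intermediate points for every step size \<open>?h n\<close> turns
    them into sequences.\<close>
  from this[of "?h _"] obtain s t s' t' where
    st: "\<And>n. 0 < s n \<and> s n < ?h n \<and> 0 < t n \<and> t n < ?h n" and
    st': "\<And>n. 0 < s' n \<and> s' n < ?h n \<and> 0 < t' n \<and> t' n < ?h n" and
    eq: "\<And>n. dir_deriv v (dir_deriv u f) (x + s n *\<^sub>R u + t n *\<^sub>R v)
      = dir_deriv u (dir_deriv v f) (x + s' n *\<^sub>R v + t' n *\<^sub>R u)"
    by simp metis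
  show ?thesis
    using LIMSEQ_unique[OF limit[OF st', of u v] limit[OF st, of v u, unfolded eq]] .
qed

section \<open>Poisson brackets from skew maps\<close>

text \<open>\<open>grad\<close> is any map representing the derivatives of smooth functions, so that
  \<open>differential\<close> can be substituted. The assumption \<open>casimir\<close> says that
  every field \<open>J (grad f x)\<close> annihilates \<open>e\<close>, so \<open>e\<close> passes
  through the bracket as a scalar.\<close>

lemma poisson_bracket_skew:
  fixes J :: "'a::euclidean_space \<Rightarrow> 'a" and e :: "'a \<Rightarrow> real"
    and grad :: "('a \<Rightarrow> real) \<Rightarrow> 'a \<Rightarrow> 'a"
  assumes J: "linear J" and skew: "\<And>a b. J a \<bullet> b = - (a \<bullet> J b)"
    and e: "e \<in> smooth_functions" and casimir: "\<And>v x. dir_deriv (J v) e x = 0"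
    and grad: "\<And>f x. f \<in> smooth_functions \<Longrightarrow> (f has_derivative (\<lambda>v. grad f x \<bullet> v)) (at x)"
  shows "poisson_bracket (\<lambda>f g x. e x * (J (grad f x) \<bullet> grad g x))"
proof -
  note diff = smooth_differentiable
  define B where "B = (\<lambda>f g x. e x * (J (grad f x) \<bullet> grad g x))"
  define P where "P f g x = J (grad f x) \<bullet> grad g x" for f g x
  have dd: "dir_deriv v f x = grad f x \<bullet> v" if "f \<in> smooth_functions" for f v x
    using dir_deriv_eqI[OF grad[OF that]] .
  have B_right: "B f g x = e x * dir_deriv (J (grad f x)) g x" if "g \<in> smooth_functions" for f g x
    by (simp add: B_def dd that inner_commute)
  have anti: "B f g x = - B g f x" for f g x
    by (simp add: B_def skew[of "grad f x" "grad g x"] inner_commute[of "grad f x"])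
  \<comment> \<open>Expansion in the orthonormal basis: the varying vector \<open>grad f x\<close>
    is replaced by derivatives in the fixed directions \<open>b\<close> and \<open>J b\<close>, so
    that \<open>P f g\<close> is visibly smooth and can be differentiated termwise.\<close>
  have P_sum: "P f g = (\<lambda>x. \<Sum>b\<in>Basis. dir_deriv b f x * dir_deriv (J b) g x)"
    if "f \<in> smooth_functions" "g \<in> smooth_functions" for f g
    unfolding P_def skew by (subst euclidean_inner) (simp add: dd that skew sum_negf)
  have P_smooth: "P f g \<in> smooth_functions"
    if "f \<in> smooth_functions" "g \<in> smooth_functions" for f g
    unfolding P_sum[OF that]
    by (intro smooth_sum smooth_mult smooth_dir_deriv that)
  have B_P: "B f g = (\<lambda>x. e x * P f g x)" for f g
    by (simp add: B_def P_def)
  \<comment> \<open>On the right the vectors \<open>J (grad g x)\<close> and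
    \<open>J (grad h x)\<close> are frozen at the point \<open>x\<close>; only second derivatives of
    \<open>g\<close> and \<open>h\<close> remain.\<close>
  have dd_P: "dir_deriv w (P g h) x = dir_deriv w (dir_deriv (J (grad g x)) h) x
      - dir_deriv w (dir_deriv (J (grad h x)) g) x"
    if g: "g \<in> smooth_functions" and h: "h \<in> smooth_functions" for g h w x
  proof -
    \<comment> \<open>Linearity in the inner direction \<open>v\<close> is clear once symmetry has
      made \<open>v\<close> the outer one.\<close>
    have lin: "linear (\<lambda>v. dir_deriv w (dir_deriv v f) x)" if "f \<in> smooth_functions" for f
      unfolding dir_deriv_commute[OF that, of w]
      by (intro linear_dir_deriv diff smooth_dir_deriv that)
    have "dir_deriv w (P g h) x = (\<Sum>b\<in>Basis. dir_deriv w (dir_deriv b g) x * dir_deriv (J b) h x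
        + dir_deriv b g x * dir_deriv w (dir_deriv (J b) h) x)"
      unfolding P_sum[OF g h]
      by (simp add: dir_deriv_sum dir_deriv_mult diff smooth_dir_deriv smooth_mult g h)
    \<comment> \<open>The minus sign is skewness: \<open>grad h x \<bullet> J b\<close> equals
      \<open>- (J (grad h x) \<bullet> b)\<close>.\<close>
    also have "\<dots> = (\<Sum>b\<in>Basis. (grad g x \<bullet> b) * dir_deriv w (dir_deriv (J b) h) x)
        - (\<Sum>b\<in>Basis. (J (grad h x) \<bullet> b) * dir_deriv w (dir_deriv b g) x)"
      by (simp add: dd g h skew sum_subtractf[symmetric] algebra_simps)
    also have "(\<Sum>b\<in>Basis. (grad g x \<bullet> b) * dir_deriv w (dir_deriv (J b) h) x)
        = dir_deriv w (dir_deriv (J (\<Sum>b\<in>Basis. (grad g x \<bullet> b) *\<^sub>R b)) h) x"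
      by (simp only: linear_sum[OF lin[OF h]] linear_cmul[OF lin[OF h]] real_scaleR_def
          linear_sum[OF J] linear_cmul[OF J])
    also have "(\<Sum>b\<in>Basis. (J (grad h x) \<bullet> b) * dir_deriv w (dir_deriv b g) x)
        = dir_deriv w (dir_deriv (\<Sum>b\<in>Basis. (J (grad h x) \<bullet> b) *\<^sub>R b) g) x"
      by (simp only: linear_sum[OF lin[OF g]] linear_cmul[OF lin[OF g]] real_scaleR_def)
    finally show ?thesis
      by (simp add: euclidean_representation)
  qed
  have BB: "B f (B g h) x = (e x)\<^sup>2 * (dir_deriv (J (grad f x)) (dir_deriv (J (grad g x)) h) x
      - dir_deriv (J (grad f x)) (dir_deriv (J (grad h x)) g) x)"
    if g: "g \<in> smooth_functions" and h: "h \<in> smooth_functions" for f g h x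
  proof -
    \<comment> \<open>In the product rule for \<open>e x * P g h x\<close> the derivative of
      \<open>e\<close> drops out by \<open>casimir\<close>; the other term brings the second factor
      \<open>e x\<close>.\<close>
    have "B f (B g h) x = e x * dir_deriv (J (grad f x)) (\<lambda>x. e x * P g h x) x"
      unfolding B_P[of g h] by (intro B_right smooth_mult e P_smooth g h)
    then show ?thesis
      by (simp add: dir_deriv_mult diff e P_smooth g h casimir dd_P power2_eq_square)
  qed
  have "poisson_bracket B"
  proof
    fix f g h :: "'a \<Rightarrow> real" and a b x
    assume f: "f \<in> smooth_functions" and g: "g \<in> smooth_functions"
    show "B f g \<in> smooth_functions"
      unfolding B_P by (intro smooth_mult e P_smooth f g)
    show "B f g = (\<lambda>x. - B g f x)"
      using anti by blast
    assume h: "h \<in> smooth_functions"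
    have "B (\<lambda>x. a * f x + b * g x) h x = a * B f h x + b * B g h x" for x
      \<comment> \<open>Antisymmetry moves the combination to the right slot, where the bracket is a
        directional derivative.\<close>
      unfolding anti[of _ h] B_right[OF smooth_linear_combination[OF f g]] B_right[OF f] B_right[OF g]
      by (simp add: dir_deriv_linear_combination diff f g algebra_simps)
    then show "B (\<lambda>x. a * f x + b * g x) h = (\<lambda>x. a * B f h x + b * B g h x)"
      by blast
    have "B f (\<lambda>x. g x * h x) x = B f g x * h x + g x * B f h x" for x
      unfolding B_right[OF smooth_mult[OF g h]] B_right[OF g] B_right[OF h]
      by (simp add: dir_deriv_mult diff g h algebra_simps)
    then show "B f (\<lambda>x. g x * h x) = (\<lambda>x. B f g x * h x + g x * B f h x)"
      by blast
    show "B f (B g h) x + B g (B h f) x + B h (B f g) x = 0"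
      unfolding BB[OF g h] BB[OF h f] BB[OF f g]
      \<comment> \<open>Fixing one direction in each rule orients the symmetry as a rewrite rule, so
        that each function's two Hessian terms take the same form and cancel.\<close>
      by (simp add: dir_deriv_commute[OF f, of "J (grad h x)"]
          dir_deriv_commute[OF g, of "J (grad h x)"]
          dir_deriv_commute[OF h, of "J (grad g x)"] algebra_simps)
  qed
  then show ?thesis
    by (simp add: B_def)
qed

section \<open>The Heisenberg case\<close>

lemma hz_bracket_zero: "hz_bracket A B = 0"
  by (cases A; cases B) (simp add: zero_prod_def)

lemma function_space_smooth: "function_space smooth_functions"
  by (simp add: function_space_def smooth_const smooth_linear_combination)

text \<open>The standard symplectic form, the common factor of \<open>heis_omega\<close> and of both
  Poisson brackets.\<close>

fun hz_symplectic :: "'n::finite hz \<Rightarrow> 'n hz \<Rightarrow> real" where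
  "hz_symplectic (x, y) (x', y') = x \<bullet> y' - x' \<bullet> y"

lemma heis_omega_eq: "heis_omega lam A B = (\<lambda>r. eta lam r * hz_symplectic A B)"
  by (cases A; cases B) simp

text \<open>The action is trivial and the quotient abelian, so every term of the cocycle identity
  vanishes. The coefficient \<open>s\<close> is left open because the lemma serves both
  \<open>eta lam\<close> and its difference from the identity.\<close>

lemma lie_cocycle2_hz_symplectic:
  fixes s :: "gq \<Rightarrow> real"
  assumes "s \<in> smooth_functions"
  shows "lie_cocycle2 (hz_bracket :: 'n::finite hz \<Rightarrow> _) smooth_functions trivial_action
    (\<lambda>A B r. s r * hz_symplectic A B)"
proof
  show "bilinear (hz_bracket :: 'n hz \<Rightarrow> _)"
    by (simp add: hz_bracket_zero bilinear_def linear_iff)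
  show "(\<lambda>r. s r * hz_symplectic A B) \<in> smooth_functions" for A B :: "'n hz"
    by (intro smooth_mult assms smooth_const)
  show "bilinear (\<lambda>A B :: 'n hz. s t * hz_symplectic A B)" for t
    by (auto simp: bilinear_def linear_iff inner_add_left inner_add_right algebra_simps)
  show "s t * hz_symplectic A A = 0" for A :: "'n hz" and t
    by (cases A) simp
  have "hz_symplectic 0 A = 0" for A :: "'n hz"
    by (cases A) (simp add: zero_prod_def)
  then show "trivial_action A (\<lambda>r. s r * hz_symplectic B C) t - trivial_action B (\<lambda>r. s r * hz_symplectic A C) t
      + trivial_action C (\<lambda>r. s r * hz_symplectic A B) t
      - s t * hz_symplectic (hz_bracket A B) C + s t * hz_symplectic (hz_bracket A C) B
      - s t * hz_symplectic (hz_bracket B C) A = 0" for A B C :: "'n hz" and t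
    by (simp add: trivial_action_def hz_bracket_zero)
qed (simp_all add: hz_bracket_zero trivial_action_def function_space_smooth smooth_const)

lemma smooth_eta: "eta lam \<in> smooth_functions"
proof -
  have "eta lam = (\<lambda>r. 1 * (1 / (2 * lam) * exp ((2 * lam) * r)) + 1 * (- 1 / (2 * lam)))"
    by (simp add: eta_def fun_eq_iff diff_divide_distrib)
  moreover have "(\<lambda>r. 1 / (2 * lam) * exp ((2 * lam) * r)) \<in> smooth_functions"
    unfolding smooth_functions_def using Ck_exp by blast
  ultimately show ?thesis
    by (simp only: smooth_linear_combination smooth_const)
qed

lemma smooth_pullback:
  fixes f :: "gq \<Rightarrow> real"
  assumes "f \<in> smooth_functions"
  shows "(pullback f :: 'n::finite heis_dual \<Rightarrow> real) \<in> smooth_functions"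
  using smooth_compose_linear[OF gmod_quotient(1) assms] by (simp add: pullback_def comp_def)

section \<open>The Poisson bracket and its comparison with the linear one\<close>

lemma heis_poisson_eq:
  "heis_poisson lam \<phi> \<psi> \<mu> =
    eta lam (gmod \<mu>) * hz_symplectic (hmod (differential \<phi> \<mu>)) (hmod (differential \<psi> \<mu>))"
  by (cases \<mu>; cases "differential \<phi> \<mu>"; cases "differential \<psi> \<mu>")
    (simp add: heis_poisson_def eta_def)

lemma linear_poisson_eq:
  "linear_poisson \<phi> \<psi> \<mu> =
    gmod \<mu> * hz_symplectic (hmod (differential \<phi> \<mu>)) (hmod (differential \<psi> \<mu>))"
  by (cases \<mu>; cases "differential \<phi> \<mu>"; cases "differential \<psi> \<mu>")
    (simp add: linear_poisson_def)

lemma poisson_bracket_heis: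
  "poisson_bracket (heis_poisson lam :: ('n::finite heis_dual \<Rightarrow> real) \<Rightarrow> _)"
proof -
  define J :: "'n heis \<Rightarrow> 'n heis" where "J = (\<lambda>(x, y, z). (- y, x, 0))"
  have symp: "hz_symplectic (hmod X) (hmod Y) = J X \<bullet> Y" for X Y
    by (cases X; cases Y) (simp add: J_def inner_commute)
  have "poisson_bracket (\<lambda>\<phi> \<psi> \<mu>. pullback (eta lam) \<mu> * (J (differential \<phi> \<mu>) \<bullet> differential \<psi> \<mu>))"
  proof (rule poisson_bracket_skew)
    show "linear J"
      by (auto simp: linear_iff J_def)
    show "J a \<bullet> b = - (a \<bullet> J b)" for a b
      by (cases a; cases b) (simp add: J_def inner_commute)
    show "pullback (eta lam) \<in> smooth_functions"
      by (intro smooth_pullback smooth_eta)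
    \<comment> \<open>The image of \<open>J\<close> lies in the kernel of \<open>gmod\<close>, so a
      function of \<open>r\<close> alone is constant along it.\<close>
    have "gmod (J v) = 0" for v
      by (cases v) (simp add: J_def)
    then show "dir_deriv (J v) (pullback (eta lam)) x = 0" for v x
      using linear_0[OF linear_dir_deriv[OF smooth_differentiable[OF smooth_eta]]]
      by (simp add: pullback_def comp_def smooth_differentiable[OF smooth_eta]
          dir_deriv_compose_linear[OF gmod_quotient(1)])
    show "(\<phi> has_derivative (\<lambda>v. differential \<phi> \<mu> \<bullet> v)) (at \<mu>)" if "\<phi> \<in> smooth_functions" for \<phi> \<mu>
      using has_derivative_differential[OF smooth_differentiable[OF that], of \<mu>]
      by (simp add: pairing_inner[abs_def])
  qed
  moreover have "heis_poisson lam =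
      (\<lambda>\<phi> \<psi> \<mu>. pullback (eta lam) \<mu> * (J (differential \<phi> \<mu>) \<bullet> differential \<psi> \<mu>))"
    by (intro ext) (simp only: heis_poisson_eq symp pullback_def comp_def)
  ultimately show ?thesis
    by simp
qed

lemma cocycle_perturbation_heis:
  "cocycle_perturbation (heis_poisson lam :: ('n::finite heis_dual \<Rightarrow> real) \<Rightarrow> _)"
proof -
  \<comment> \<open>The difference of the coefficients in \<open>heis_poisson_eq\<close> and
    \<open>linear_poisson_eq\<close>.\<close>
  have "(\<lambda>r::gq. 1 * eta lam r + (- 1) * r) \<in> smooth_functions"
    by (intro smooth_linear_combination smooth_eta smooth_linear linear_ident)
  from lie_cocycle2_hz_symplectic[OF this] show ?thesis
    unfolding cocycle_perturbation_def
    by (intro conjI exI[of _ "\<lambda>A B r. (1 * eta lam r + (- 1) * r) * hz_symplectic A B"]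
        poisson_bracket_heis)
      (simp_all only: heis_poisson_eq linear_poisson_eq, simp_all add: algebra_simps)
qed

section \<open>The inclusions into the smooth functions\<close>

lemma smooth_linear_function: "linear_function X \<in> smooth_functions"
  by (rule smooth_linear)
    (simp add: linear_function_def pairing_inner linear_iff inner_add_right del: split_paired_All)

lemma linear_embedding_pullback:
  "linear_embedding smooth_functions (smooth_functions :: ('n::finite heis_dual \<Rightarrow> real) set) pullback"
proof -
  \<comment> \<open>Since \<open>gmod\<close> is surjective, a pull-back determines all values of
    the original function.\<close>
  have "inj (pullback :: _ \<Rightarrow> 'n heis_dual \<Rightarrow> real)"
    unfolding pullback_def by (rule injI) (metis gmod_quotient(2) surj_fun_eq)
  then show ?thesis
    unfolding linear_embedding_def
  proof (intro conjI ballI allI)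
    show "pullback (\<lambda>t. a * f t + b * g t) = (\<lambda>\<mu> :: 'n heis_dual. a * pullback f \<mu> + b * pullback g \<mu>)"
      for f g a b
      by (simp add: pullback_def comp_def)
  qed (auto intro: inj_on_subset smooth_pullback)
qed

lemma linear_function_Int_pullback:
  "range (linear_function :: 'n::finite heis \<Rightarrow> 'n heis_dual \<Rightarrow> real) \<inter> pullback ` smooth_functions =
    linear_function ` lie_center heis_bracket" (is "?L = ?R")
proof
  show "?L \<subseteq> ?R"
  proof
    fix g assume "g \<in> ?L"
    then obtain X f where "g = linear_function X" and f: "g = pullback f"
      by blast
    moreover obtain x y z where "X = (x, y, z)"
      by (cases X)
    ultimately have g: "g = linear_function (x, y, z)"
      by simp
    \<comment> \<open>A pull-back cannot distinguish points with equal last coordinate. Testing at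
      the point with coordinates \<open>x\<close> and \<open>y\<close> themselves makes the linear
      function return a sum of squares.\<close>
    have "g (x, y, 0) = g (0, 0, 0)"
      by (simp add: f pullback_def)
    then have "x \<bullet> x + y \<bullet> y = 0"
      by (simp add: g linear_function_def)
    then have "x = 0" "y = 0"
      by (metis add_nonneg_eq_0_iff inner_eq_zero_iff inner_ge_zero)+
    then show "g \<in> ?R"
      by (auto simp: g heis_center)
  qed
  have "linear_function (0, 0, z) = (pullback (\<lambda>r. z * r) :: 'n heis_dual \<Rightarrow> real)" for z
    by (auto simp: linear_function_def pullback_def)
  moreover have "(\<lambda>r::gq. z * r) \<in> smooth_functions" for z
    by (intro smooth_linear linear_times)
  ultimately show "?R \<subseteq> ?L"
    by (auto simp: heis_center)
qed

theorem proposition2p5: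
  fixes lam :: real
  assumes "lam \<noteq> 0"
  shows
    "lie_cocycle2 (hz_bracket :: 'n::finite hz \<Rightarrow> 'n hz \<Rightarrow> 'n hz)
       smooth_functions trivial_action (heis_omega lam)
     \<and>
     (poisson_bracket
       (heis_poisson lam :: ('n heis_dual \<Rightarrow> real) \<Rightarrow> ('n heis_dual \<Rightarrow> real) \<Rightarrow> ('n heis_dual \<Rightarrow> real)) \<and>
      (\<forall>A B :: 'n hz. \<forall>\<nu> :: 'n hz_dual. hz_pairing (hz_bracket A B) \<nu> = 0) \<and>
      (\<forall>\<phi>\<in>smooth_functions. \<forall>\<psi>\<in>smooth_functions. \<forall>\<mu> :: 'n heis_dual.
         heis_poisson lam \<phi> \<psi> \<mu> =
           hz_pairing (hz_bracket (hmod (differential \<phi> \<mu>)) (hmod (differential \<psi> \<mu>)))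
             (hz_dual_part \<mu>)
           + heis_omega lam (hmod (differential \<phi> \<mu>)) (hmod (differential \<psi> \<mu>)) (gmod \<mu>)))
     \<and>
     (linear_embedding smooth_functions (smooth_functions :: ('n heis_dual \<Rightarrow> real) set) pullback \<and>
      range (linear_function :: 'n heis \<Rightarrow> 'n heis_dual \<Rightarrow> real) \<subseteq> smooth_functions \<and>
      range (linear_function :: 'n heis \<Rightarrow> 'n heis_dual \<Rightarrow> real) \<inter> pullback ` smooth_functions =
        linear_function ` lie_center heis_bracket)
     \<and>
     cocycle_perturbation
       (heis_poisson lam :: ('n heis_dual \<Rightarrow> real) \<Rightarrow> ('n heis_dual \<Rightarrow> real) \<Rightarrow> ('n heis_dual \<Rightarrow> real))"
proof (intro conjI allI ballI)
  have "(heis_omega lam :: 'n hz \<Rightarrow> _) = (\<lambda>A B r. eta lam r * hz_symplectic A B)"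
    by (intro ext) (simp only: heis_omega_eq)
  then show "lie_cocycle2 (hz_bracket :: 'n hz \<Rightarrow> _) smooth_functions trivial_action (heis_omega lam)"
    using lie_cocycle2_hz_symplectic[OF smooth_eta] by simp
  show "range (linear_function :: 'n heis \<Rightarrow> _) \<subseteq> smooth_functions"
    using smooth_linear_function by blast
\<comment> \<open>As \<open>hz_bracket\<close> is zero, the linear term vanishes and the
  decomposition becomes \<open>heis_poisson_eq\<close>.\<close>
qed (simp_all only: poisson_bracket_heis cocycle_perturbation_heis linear_embedding_pullback
    linear_function_Int_pullback heis_poisson_eq heis_omega_eq hz_bracket_zero hz_pairing_inner
    inner_zero_left add_0_left)

end
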